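(* Let $\mathbb{Q}$ be a probability measure on $(\mathbf{F},\mathcal{F})$ such that $Y$ is spectrally decomposable with index $\alpha>0$ with respect to $\mathbb{Q}$. Then the exceedance random measure $\xi$ is mass-stationary with respect to $\mathbb{Q}$ if and only if $$\mathbb{E}_{\mathbb{Q}}\int g(\theta_sW,-s)\,\mathbf 1\{|W_s|>0\}\,\lambda(ds)=\mathbb{E}_{\mathbb{Q}}\int g(|W_s|^{-1}W,s)\,|W_s|^\alpha\,\lambda(ds)$$ holds for all measurable $g\colon\mathbf{F}\times\mathbb{G}\to[0,\infty]$.
   Context: $\mathbb{G}$ is a second countable locally compact Hausdorff Abelian group (additive, neutral element $0$) with Borel $\sigma$-field $\mathcal{G}$ and non-trivial Haar measure $\lambda$. $\mathbb{H}$ is a non-empty Polish space with Borel $\sigma$-field $\mathcal{H}$ which is a measurable cone: there is a measurable map $(u,x)\mapsto ux$ from $(0,\infty)\times\mathbb{H}$ to $\mathbb{H}$ with $1x=x$, $u(vx)=(uv)x$. $|\cdot|\colon\mathbb{H}\to[0,\infty)$ is measurable with $|ux|=u|x|$ for $u>0$; $x_0\in\mathbb{H}$ is a fixed element with $|x_0|=1$. For $\omega\in\mathbb{H}^{\mathbb{G}}$ let $\theta_s\omega:=\omega(\cdot+s)$ and $(u\omega)(s):=u\,\omega(s)$. $\mathbf{F}\subset\mathbb{H}^{\mathbb{G}}$ is a set of functions closed under all $\theta_s$ and under multiplication by $u\in(0,\infty)$, with a $\sigma$-field $\mathcal{F}$ such that $(\omega,s)\mapsto(\theta_s\omega,\omega(0))$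 (on $\mathbf{F}\times\mathbb{G}$) and $(\omega,u)\mapsto u\omega$ (on $\mathbf{F}\times(0,\infty)$) are measurable. If $\mathbb{G}$ is discrete, $\mathbf{F}=\mathbb{H}^{\mathbb{G}}$ with the product $\sigma$-field. $Y_s(\omega):=\omega(s)$, and $Y=(Y_s)_{s\in\mathbb{G}}$ is the identity on $\mathbf{F}$. $W_s:=|Y_0|^{-1}Y_s$ if $|Y_0|>0$ and $W_s:=x_0$ otherwise; $W=(W_s)_{s\in\mathbb{G}}$. Terms containing the factor $|W_s|^\alpha$ are $0$ when $|W_s|=0$. $Y$ (or $\mathbb{Q}$) is spectrally decomposable with index $\alpha>0$ if there is a probability measure $\mathbb{Q}'$ on $\mathbf{F}$ with $\mathbb{Q}'(|Y_0|=1)=1$ and $\mathbb{Q}=\iint\mathbf 1\{u\omega\in\cdot,\,u>1\}\,\alpha u^{-\alpha-1}\,\mathbb{Q}'(d\omega)\,du$. The exceedance random measure is $\xi:=\int\mathbf 1\{s\in\cdot,\,|Y_s|>1\}\,\lambda(ds)$. It is called mass-stationary with respect to $\mathbb{Q}$ if for all measurable $g\colon\mathbf{F}\times\mathbb{G}\to[0,\infty]$ $$\mathbb{E}_{\mathbb{Q}}\int g(\theta_sY,-s)\,\xi(ds)=\mathbb{E}_{\mathbb{Q}}\int g(Y,s)\,\xi(ds).$$ $\mathbb{E}_{\mathbb{Q}}$ denotes integration with respect to $\mathbb{Q}$. *)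

theory Defs
  imports "HOL-Probability.Probability"
begin

text \<open>Local finiteness, invariance and non-triviality characterise a Haar measure on a second
  countable locally compact Hausdorff group: every locally finite Borel measure on such a space is
  regular, so regularity need not be demanded separately.\<close>

definition haar_measure :: "'g::{topological_ab_group_add, second_countable_topology, t2_space} measure \<Rightarrow> bool"
  where "haar_measure lam \<longleftrightarrow>
    sets lam = sets borel \<and>
    (\<forall>K. compact K \<longrightarrow> emeasure lam K < \<infinity>) \<and>
    (\<forall>s. \<forall>B\<in>sets borel. emeasure lam ((\<lambda>t. t + s) ` B) = emeasure lam B) \<and>
    emeasure lam UNIV \<noteq> 0"

definition shift :: "'g::ab_group_add \<Rightarrow> ('g \<Rightarrow> 'h) \<Rightarrow> 'g \<Rightarrow> 'h"
  where "shift s \<omega> = (\<lambda>t. \<omega> (t + s))"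

definition scale_fun :: "(real \<Rightarrow> 'h \<Rightarrow> 'h) \<Rightarrow> real \<Rightarrow> ('g \<Rightarrow> 'h) \<Rightarrow> 'g \<Rightarrow> 'h"
  where "scale_fun scl u \<omega> = (\<lambda>s. scl u (\<omega> s))"

text \<open>The cone operation \<open>scl u x\<close> stands for \<open>ux\<close> and is only constrained for \<open>u > 0\<close>;
  \<open>mag x\<close> stands for \<open>\<bar>x\<bar>\<close>. The measurable space of functions is encoded by \<open>MF\<close>, of which
  only \<open>space MF\<close> and \<open>sets MF\<close> are used. A Polish space is represented by the class
  \<open>polish_space\<close>; only its topology, not the chosen metric, enters.\<close>

locale cone_valued_functions =
  fixes lam :: "'g::{topological_ab_group_add, second_countable_topology, t2_space} measure"
    and scl :: "real \<Rightarrow> 'h::polish_space \<Rightarrow> 'h"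
    and mag :: "'h \<Rightarrow> real"
    and x0 :: 'h
    and MF :: "('g \<Rightarrow> 'h) measure"
  assumes locally_compact: "locally_compact_space (euclidean :: 'g topology)"
    and haar: "haar_measure lam"
    and scl_measurable:
      "(\<lambda>(u, x). scl u x) \<in> restrict_space borel {0<..} \<Otimes>\<^sub>M borel \<rightarrow>\<^sub>M borel"
    and scl_one: "scl 1 x = x"
    and scl_scl: "0 < u \<Longrightarrow> 0 < v \<Longrightarrow> scl u (scl v x) = scl (u * v) x"
    and mag_nonneg: "0 \<le> mag x"
    and mag_measurable: "mag \<in> borel_measurable borel"
    and mag_scl: "0 < u \<Longrightarrow> mag (scl u x) = u * mag x"
    and mag_x0: "mag x0 = 1"
    and shift_closed: "\<omega> \<in> space MF \<Longrightarrow> shift s \<omega> \<in> space MF"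
    and scale_closed: "\<omega> \<in> space MF \<Longrightarrow> 0 < u \<Longrightarrow> scale_fun scl u \<omega> \<in> space MF"
    and shift_eval_measurable:
      "(\<lambda>(\<omega>, s). (shift s \<omega>, \<omega> 0)) \<in> MF \<Otimes>\<^sub>M borel \<rightarrow>\<^sub>M MF \<Otimes>\<^sub>M borel"
    and scale_measurable:
      "(\<lambda>(\<omega>, u). scale_fun scl u \<omega>) \<in> MF \<Otimes>\<^sub>M restrict_space borel {0<..} \<rightarrow>\<^sub>M MF"
    and discrete:
      "(\<forall>s::'g. open {s}) \<Longrightarrow> space MF = UNIV \<and> sets MF = sets (Pi\<^sub>M UNIV (\<lambda>_. borel))"

definition W :: "(real \<Rightarrow> 'h \<Rightarrow> 'h) \<Rightarrow> ('h \<Rightarrow> real) \<Rightarrow> 'h \<Rightarrow> ('g::zero \<Rightarrow> 'h) \<Rightarrow> 'g \<Rightarrow> 'h"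
  where "W scl mag x0 \<omega> = (\<lambda>s. if mag (\<omega> 0) > 0 then scl (inverse (mag (\<omega> 0))) (\<omega> s) else x0)"

definition spectrally_decomposable ::
  "(real \<Rightarrow> 'h \<Rightarrow> 'h) \<Rightarrow> ('h \<Rightarrow> real) \<Rightarrow> ('g::zero \<Rightarrow> 'h) measure \<Rightarrow> real \<Rightarrow> ('g \<Rightarrow> 'h) measure \<Rightarrow> bool"
  where "spectrally_decomposable scl mag MF \<alpha> Q \<longleftrightarrow>
    \<alpha> > 0 \<and>
    (\<exists>Q'. prob_space Q' \<and> sets Q' = sets MF \<and>
      emeasure Q' {\<omega> \<in> space MF. mag (\<omega> 0) = 1} = 1 \<and>
      (\<forall>A\<in>sets MF. emeasure Q A =
        (\<integral>\<^sup>+u. (\<integral>\<^sup>+\<omega>. indicator A (scale_fun scl u \<omega>) * indicator {1<..} u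
          * ennreal (\<alpha> * u powr (- \<alpha> - 1)) \<partial>Q') \<partial>lborel)))"

definition exceedance ::
  "'g measure \<Rightarrow> ('h \<Rightarrow> real) \<Rightarrow> ('g \<Rightarrow> 'h) \<Rightarrow> 'g measure"
  where "exceedance lam mag \<omega> = density lam (indicator {s. mag (\<omega> s) > 1})"

definition mass_stationary ::
  "('g::{ab_group_add, topological_space} \<Rightarrow> 'h) measure \<Rightarrow> ('g \<Rightarrow> 'h) measure
    \<Rightarrow> (('g \<Rightarrow> 'h) \<Rightarrow> 'g measure) \<Rightarrow> bool"
  where "mass_stationary MF Q \<xi> \<longleftrightarrow>
    (\<forall>g::('g \<Rightarrow> 'h) \<times> 'g \<Rightarrow> ennreal. g \<in> borel_measurable (MF \<Otimes>\<^sub>M borel) \<longrightarrow>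
      (\<integral>\<^sup>+\<omega>. (\<integral>\<^sup>+s. g (shift s \<omega>, - s) \<partial>\<xi> \<omega>) \<partial>Q) = (\<integral>\<^sup>+\<omega>. (\<integral>\<^sup>+s. g (\<omega>, s) \<partial>\<xi> \<omega>) \<partial>Q))"

end

theory Submission
  imports Defs "HOL-Real_Asymp.Real_Asymp"
begin

text \<open>Spectral decomposability says that \<open>Y\<close> is distributed as \<open>u * \<omega>\<close> with \<open>u\<close> Pareto distributed,
  \<open>\<omega>\<close> distributed according to \<open>R\<close>, and \<open>\<bar>\<omega> 0\<bar> = 1\<close> almost surely; then \<open>W\<close> recovers \<open>\<omega>\<close>. So
  mass-stationarity is an identity for the product of the Pareto law, \<open>R\<close> and \<open>\<lambda>\<close>, and the identity for
  \<open>W\<close> is one for \<open>R\<close> and \<open>\<lambda>\<close> alone. The latter gives the former by integrating over \<open>u\<close>. Conversely,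
  conditioning the exceedances at the shifted origin to be above a high level \<open>r\<close> and letting \<open>r\<close> tend to
  infinity removes the restriction \<open>u * \<bar>\<omega> s\<bar> > 1\<close>, by monotone convergence.\<close>

section \<open>The Pareto law of the scale variable\<close>

text \<open>The radial weight of the spectral decomposition, packaged as a measure on all reals so
  that Tonelli's theorem for product measures applies to the scale variable.\<close>

definition pareto :: "real \<Rightarrow> real measure"
  where "pareto \<alpha> = density lborel (\<lambda>u. indicator {1<..} u * ennreal (\<alpha> * u powr (- \<alpha> - 1)))"

lemma sets_pareto [simp, measurable_cong]: "sets (pareto \<alpha>) = sets borel"
  and space_pareto [simp]: "space (pareto \<alpha>) = UNIV"
  by (simp_all add: pareto_def)

lemma nn_integral_pareto:
  assumes [measurable]: "f \<in> borel_measurable borel"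
  shows "(\<integral>\<^sup>+u. f u \<partial>pareto \<alpha>) =
    (\<integral>\<^sup>+u. indicator {1<..} u * ennreal (\<alpha> * u powr (- \<alpha> - 1)) * f u \<partial>lborel)"
  unfolding pareto_def by (subst nn_integral_density) simp_all

lemma AE_pareto_gt_1: "AE u in pareto \<alpha>. 1 < u"
  unfolding pareto_def by (subst AE_density) (auto split: split_indicator)

text \<open>\<open>- (x powr - \<alpha>)\<close> is an antiderivative of the density and tends to 0
  at infinity. The maximum with 1 is there because the density lives on
  \<open>{1<..}\<close>.\<close>

lemma emeasure_pareto_greaterThan:
  assumes "0 < \<alpha>"
  shows "emeasure (pareto \<alpha>) {a<..} = ennreal (max 1 a powr - \<alpha>)"
proof -
  let ?b = "max 1 a"
  have "emeasure (pareto \<alpha>) {a<..} = (\<integral>\<^sup>+u. indicator {a<..} u \<partial>pareto \<alpha>)"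
    by simp
  \<comment> \<open>The endpoint \<open>?b\<close> is Lebesgue null, so the open half-line may be
    closed; the fundamental theorem is then applied on \<open>{?b ..}\<close>.\<close>
  also have "\<dots> = (\<integral>\<^sup>+u. ennreal (\<alpha> * u powr (- \<alpha> - 1)) * indicator {?b ..} u \<partial>lborel)"
    by (subst nn_integral_pareto, simp, intro nn_integral_cong_AE,
        use AE_lborel_singleton[of ?b] in eventually_elim) (auto split: split_indicator)
  also have "\<dots> = ennreal (0 - (- (?b powr - \<alpha>)))"
  proof (rule nn_integral_FTC_atLeast)
    show "((\<lambda>x. - (x powr - \<alpha>)) has_real_derivative \<alpha> * x powr (- \<alpha> - 1)) (at x)"
      if "?b \<le> x" for x
      using that by (auto intro!: derivative_eq_intros simp: powr_diff powr_minus field_simps)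
    show "((\<lambda>x. - (x powr - \<alpha>)) \<longlongrightarrow> 0) at_top"
      using tendsto_minus[OF tendsto_neg_powr[of "- \<alpha>", OF _ filterlim_ident]] assms by simp
  qed (use assms in auto)
  finally show ?thesis by simp
qed

lemma prob_space_pareto:
  assumes "0 < \<alpha>"
  shows "prob_space (pareto \<alpha>)"
proof
  have "emeasure (pareto \<alpha>) (space (pareto \<alpha>)) = emeasure (pareto \<alpha>) {1<..}"
    using AE_pareto_gt_1[of \<alpha>] by (intro emeasure_eq_AE) auto
  then show "emeasure (pareto \<alpha>) (space (pareto \<alpha>)) = 1"
    using assms by (simp add: emeasure_pareto_greaterThan)
qed

text \<open>Substitute \<open>u = m * v\<close>. The density is homogeneous of degree
  \<open>- \<alpha> - 1\<close> and the Jacobian contributes \<open>m\<close>, so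
  \<open>m powr \<alpha>\<close> cancels the resulting factor. The two constraints trade places:
  \<open>m < u\<close> becomes the support condition \<open>1 < v\<close>, and the support condition
  \<open>1 < u\<close> becomes \<open>1 < v * m\<close>. This is the source of the weight with
  exponent \<alpha> in the identity for \<open>W\<close>.\<close>

lemma nn_integral_pareto_rescale:
  assumes [measurable]: "f \<in> borel_measurable borel" and "0 < m"
  shows "(\<integral>\<^sup>+u. f (u / m) * indicator {m<..} u \<partial>pareto \<alpha>) * ennreal (m powr \<alpha>) =
    (\<integral>\<^sup>+v. f v * indicator {v. 1 < v * m} v \<partial>pareto \<alpha>)"
proof -
  have powr: "m powr \<alpha> * (m * (m * x) powr (- \<alpha> - 1)) = x powr (- \<alpha> - 1)" if "0 < x" for x
    using that \<open>0 < m\<close> by (simp add: powr_mult powr_diff powr_minus field_simps)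
  have "(\<integral>\<^sup>+u. f (u / m) * indicator {m<..} u \<partial>pareto \<alpha>) =
      (\<integral>\<^sup>+u. indicator {1<..} u * ennreal (\<alpha> * u powr (- \<alpha> - 1)) * (f (u / m) * indicator {m<..} u) \<partial>lborel)"
    by (rule nn_integral_pareto) measurable
  also have "\<dots> = ennreal \<bar>m\<bar> * (\<integral>\<^sup>+x. indicator {1<..} (0 + m * x) * ennreal (\<alpha> * (0 + m * x) powr (- \<alpha> - 1)) *
      (f ((0 + m * x) / m) * indicator {m<..} (0 + m * x)) \<partial>lborel)"
    using \<open>0 < m\<close> by (intro nn_integral_real_affine) auto
  finally have "(\<integral>\<^sup>+u. f (u / m) * indicator {m<..} u \<partial>pareto \<alpha>) * ennreal (m powr \<alpha>) = (\<integral>\<^sup>+x. ennreal (m powr \<alpha>) * (ennreal m *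
      (indicator {1<..} (m * x) * ennreal (\<alpha> * (m * x) powr (- \<alpha> - 1)) *
      (f x * indicator {m<..} (m * x)))) \<partial>lborel)"
    using \<open>0 < m\<close> by (simp add: nn_integral_cmult mult.commute)
  also have "\<dots> = (\<integral>\<^sup>+x. indicator {1<..} x * ennreal (\<alpha> * x powr (- \<alpha> - 1)) *
      (f x * indicator {v. 1 < v * m} x) \<partial>lborel)"
  proof (rule nn_integral_cong)
    fix x :: real
    show "ennreal (m powr \<alpha>) * (ennreal m * (indicator {1<..} (m * x) * ennreal (\<alpha> * (m * x) powr (- \<alpha> - 1)) *
        (f x * indicator {m<..} (m * x)))) =
      indicator {1<..} x * ennreal (\<alpha> * x powr (- \<alpha> - 1)) * (f x * indicator {v. 1 < v * m} x)"
    proof (cases "1 < x \<and> 1 < x * m")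
      case True
      have eq: "m powr \<alpha> * (m * (\<alpha> * (m * x) powr (- \<alpha> - 1))) = \<alpha> * x powr (- \<alpha> - 1)"
        using powr[of x] True by (simp add: mult.left_commute[of _ \<alpha>])
      have "ennreal (m powr \<alpha>) * ennreal m * ennreal (\<alpha> * (m * x) powr (- \<alpha> - 1)) =
          ennreal (\<alpha> * x powr (- \<alpha> - 1))"
        using \<open>0 < m\<close> by (simp add: ennreal_mult'[symmetric] mult.assoc eq)
      moreover have "1 < m * x" using True by (simp add: mult.commute)
      ultimately show ?thesis
        using True \<open>0 < m\<close> by (simp add: mult.assoc[symmetric])
    qed (use \<open>0 < m\<close> in \<open>auto split: split_indicator simp: mult.commute\<close>)
  qed
  also have "\<dots> = (\<integral>\<^sup>+v. f v * indicator {v. 1 < v * m} v \<partial>pareto \<alpha>)"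
    by (rule nn_integral_pareto[symmetric]) measurable
  finally show ?thesis .
qed

section \<open>Sigma-finiteness of Haar measure, measurability of shift, scaling and
  evaluation\<close>

text \<open>Local compactness gives every point an open neighbourhood inside a compact set, hence of
  finite measure; by the Lindelof property countably many of these cover the group. Every later
  interchange of integrals with \<open>lam\<close> rests on this.\<close>

lemma sigma_finite_measure_haar:
  fixes lam :: "'g::{topological_ab_group_add, second_countable_topology, t2_space} measure"
  assumes lc: "locally_compact_space (euclidean :: 'g topology)" and haar: "haar_measure lam"
  shows "sigma_finite_measure lam"
proof -
  have sets: "sets lam = sets borel" and fin: "\<And>K. compact K \<Longrightarrow> emeasure lam K < \<infinity>"
    using haar by (auto simp: haar_measure_def)
  have "\<exists>U K. open U \<and> compact K \<and> x \<in> U \<and> U \<subseteq> K" for x :: 'g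
    using lc by (auto simp: locally_compact_space_def)
  then obtain U K where UK: "\<And>x::'g. open (U x)" "\<And>x. compact (K x)" "\<And>x. x \<in> U x" "\<And>x. U x \<subseteq> K x"
    by metis
  obtain F where F: "F \<subseteq> range U" "countable F" "\<Union>F = \<Union>(range U)"
    using Lindelof[of "range U"] UK(1) by (metis rangeE)
  show ?thesis
  proof (unfold sigma_finite_measure_def, intro exI[of _ F] conjI ballI)
    show "F \<subseteq> sets lam" using F(1) UK(1) sets by auto
    show "\<Union>F = space lam" using F(3) UK(3) sets_eq_imp_space_eq[OF sets] by auto
    show "emeasure lam A \<noteq> \<infinity>" if A: "A \<in> F" for A
    proof -
      obtain x where "A = U x" using F(1) A by blast
      then have "emeasure lam A \<le> emeasure lam (K x)"
        using UK by (intro emeasure_mono) (auto simp: sets intro: borel_closed compact_imp_closed)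
      then show ?thesis using fin[OF UK(2)[of x]] by auto
    qed
  qed (rule F(2))
qed

text \<open>\<open>scale_fun scl u\<close> is only controlled for \<open>u > 0\<close>; this total version is measurable
  without restricting the scalars.\<close>

definition pscale :: "(real \<Rightarrow> 'h \<Rightarrow> 'h) \<Rightarrow> real \<Rightarrow> ('g \<Rightarrow> 'h) \<Rightarrow> 'g \<Rightarrow> 'h"
  where "pscale scl u = scale_fun scl (if 0 < u then u else 1)"

context cone_valued_functions
begin

lemma sets_lam [measurable_cong]: "sets lam = sets borel"
  using haar by (simp add: haar_measure_def)

sublocale lam: sigma_finite_measure lam
  using locally_compact haar by (rule sigma_finite_measure_haar)

lemma measurable_pscale [measurable (raw)]:
  assumes [measurable]: "f \<in> M \<rightarrow>\<^sub>M MF" "u \<in> borel_measurable M"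
  shows "(\<lambda>x. pscale scl (u x) (f x)) \<in> M \<rightarrow>\<^sub>M MF"
proof -
  have "(\<lambda>x. (f x, if 0 < u x then u x else 1)) \<in> M \<rightarrow>\<^sub>M MF \<Otimes>\<^sub>M restrict_space borel {0<..}"
    by (intro measurable_Pair assms(1) measurable_restrict_space2) auto
  from measurable_compose[OF this scale_measurable] show ?thesis
    by (simp add: pscale_def)
qed

lemma measurable_shift [measurable (raw)]:
  assumes [measurable]: "f \<in> M \<rightarrow>\<^sub>M MF" "s \<in> borel_measurable M"
  shows "(\<lambda>x. shift (s x) (f x)) \<in> M \<rightarrow>\<^sub>M MF"
proof -
  have "(\<lambda>x. (f x, s x)) \<in> M \<rightarrow>\<^sub>M MF \<Otimes>\<^sub>M borel" by measurable
  from measurable_compose[OF measurable_compose[OF this shift_eval_measurable] measurable_fst]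
  show ?thesis by simp
qed

text \<open>Evaluation at \<open>s\<close> is evaluation at 0 after a shift by \<open>s\<close>, and
  only the latter is assumed measurable.\<close>

lemma measurable_eval [measurable (raw)]:
  assumes [measurable]: "f \<in> M \<rightarrow>\<^sub>M MF" "s \<in> borel_measurable M"
  shows "(\<lambda>x. f x (s x)) \<in> borel_measurable M"
proof -
  have "(\<lambda>x. (shift (s x) (f x), 0)) \<in> M \<rightarrow>\<^sub>M MF \<Otimes>\<^sub>M borel" by measurable
  from measurable_compose[OF measurable_compose[OF this shift_eval_measurable] measurable_snd]
  show ?thesis by (simp add: shift_def)
qed

lemma measurable_mag_eval [measurable (raw)]:
  assumes [measurable]: "f \<in> M \<rightarrow>\<^sub>M MF" "s \<in> borel_measurable M"
  shows "(\<lambda>x. mag (f x (s x))) \<in> borel_measurable M"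
  by (rule measurable_compose[OF measurable_eval[OF assms] mag_measurable])

lemma measurable_uminus_group [measurable (raw)]:
  assumes "s \<in> borel_measurable M"
  shows "(\<lambda>x. - s x :: 'g) \<in> borel_measurable M"
  by (rule measurable_compose[OF assms]) (intro borel_measurable_continuous_onI continuous_intros)

lemma pscale_pos: "0 < u \<Longrightarrow> pscale scl u = scale_fun scl u"
  by (simp add: pscale_def)

lemma mag_pscale: "0 < u \<Longrightarrow> mag (pscale scl u \<omega> s) = u * mag (\<omega> s)"
  by (simp add: pscale_def scale_fun_def mag_scl)

lemma pscale_pscale: "0 < u \<Longrightarrow> 0 < v \<Longrightarrow> pscale scl u (pscale scl v \<omega>) = pscale scl (u * v) \<omega>"
  by (simp add: pscale_def scale_fun_def scl_scl)

lemma pscale_one: "pscale scl 1 \<omega> = \<omega>"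
  by (simp add: pscale_def scale_fun_def scl_one)

lemma shift_pscale: "shift s (pscale scl u \<omega>) = pscale scl u (shift s \<omega>)"
  by (simp add: pscale_def scale_fun_def shift_def)

end

section \<open>The spectral measure, and from the identity for \<open>W\<close> to
  exceedances\<close>

text \<open>\<open>R\<close> is one fixed witness of spectral decomposability, written
  \<open>Q'\<close> in that definition. The law of \<open>Y\<close> is built from \<open>R\<close>
  further below, so the two implications can be proved without it.\<close>

locale spectral_measure = cone_valued_functions lam scl mag x0 MF + R: prob_space R
  for lam :: "'g::{topological_ab_group_add, second_countable_topology, t2_space} measure"
    and scl :: "real \<Rightarrow> 'h::polish_space \<Rightarrow> 'h"
    and mag :: "'h \<Rightarrow> real"
    and x0 :: 'h
    and MF R :: "('g \<Rightarrow> 'h) measure" +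
  fixes \<alpha> :: real
  assumes alpha_pos: "0 < \<alpha>"
    and sets_R [measurable_cong]: "sets R = sets MF"
    and AE_mag_0: "AE \<omega> in R. mag (\<omega> 0) = 1"
begin

sublocale P: prob_space "pareto \<alpha>"
  using alpha_pos by (rule prob_space_pareto)

sublocale Rlam: pair_sigma_finite R lam ..

text \<open>The scale \<open>u\<close> is kept apart from the pair of function and location, since
  in both implications \<open>u\<close> is interchanged with that pair as a whole.\<close>

sublocale PRlam: pair_sigma_finite "pareto \<alpha>" "R \<Otimes>\<^sub>M lam" ..

lemma space_R: "space R = space MF"
  by (rule sets_eq_imp_space_eq[OF sets_R])

lemma AE_Rlam_mag_0: "AE x in R \<Otimes>\<^sub>M lam. mag (fst x 0) = 1"
  by (rule Rlam.AE_pair_measure) (use AE_mag_0 in \<open>measurable, auto elim!: eventually_mono\<close>)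

text \<open>Idea: apply the hypothesis to \<open>g (pscale scl u \<eta>, t) * indicator {1<..} (u * mag (\<eta> 0))\<close> for
  every fixed \<open>u\<close>, and substitute \<open>u = v * mag (\<omega> s)\<close> in the outer integral.\<close>

lemma palm_imp_tail:
  fixes g :: "('g \<Rightarrow> 'h) \<times> 'g \<Rightarrow> ennreal"
  assumes palm: "\<And>g :: ('g \<Rightarrow> 'h) \<times> 'g \<Rightarrow> ennreal. g \<in> borel_measurable (MF \<Otimes>\<^sub>M borel) \<Longrightarrow>
      (\<integral>\<^sup>+(\<omega>, s). g (shift s \<omega>, - s) * indicator {0<..} (mag (\<omega> s)) \<partial>(R \<Otimes>\<^sub>M lam)) =
      (\<integral>\<^sup>+(\<omega>, s). g (pscale scl (inverse (mag (\<omega> s))) \<omega>, s) * ennreal (mag (\<omega> s) powr \<alpha>)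
        \<partial>(R \<Otimes>\<^sub>M lam))"
    and g [measurable]: "g \<in> borel_measurable (MF \<Otimes>\<^sub>M borel)"
  shows "(\<integral>\<^sup>+u. \<integral>\<^sup>+(\<omega>, s). g (pscale scl u (shift s \<omega>), - s) * indicator {1<..} (u * mag (\<omega> s))
        \<partial>(R \<Otimes>\<^sub>M lam) \<partial>pareto \<alpha>) =
      (\<integral>\<^sup>+u. \<integral>\<^sup>+(\<omega>, s). g (pscale scl u \<omega>, s) * indicator {1<..} (u * mag (\<omega> s))
        \<partial>(R \<Otimes>\<^sub>M lam) \<partial>pareto \<alpha>)"
proof -
  let ?M = "R \<Otimes>\<^sub>M lam"
  have fixed: "(\<integral>\<^sup>+(\<omega>, s). g (pscale scl u (shift s \<omega>), - s) * indicator {1<..} (u * mag (\<omega> s)) \<partial>?M) =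
      (\<integral>\<^sup>+(\<omega>, s). g (pscale scl (u / mag (\<omega> s)) \<omega>, s) * indicator {0<..} (u - mag (\<omega> s)) *
        ennreal (mag (\<omega> s) powr \<alpha>) \<partial>?M)" if u: "1 < u" for u
  proof -
    let ?g = "\<lambda>(\<eta>, t). g (pscale scl u \<eta>, t) * indicator {1<..} (u * mag (\<eta> 0)) :: ennreal"
    \<comment> \<open>\<open>?g\<close> reads the magnitude at the origin, which after the shift is
      that of \<open>\<omega> s\<close>. An exceedance forces \<open>mag (\<omega> s)\<close> to be
      positive, so the indicator of positivity may be inserted.\<close>
    have "(\<integral>\<^sup>+(\<omega>, s). g (pscale scl u (shift s \<omega>), - s) * indicator {1<..} (u * mag (\<omega> s)) \<partial>?M) =
        (\<integral>\<^sup>+(\<omega>, s). ?g (shift s \<omega>, - s) * indicator {0<..} (mag (\<omega> s)) \<partial>?M)"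
      using u mag_nonneg
      by (intro nn_integral_cong) (auto simp: shift_def less_le split: split_indicator)
    also have "\<dots> = (\<integral>\<^sup>+(\<omega>, s). ?g (pscale scl (inverse (mag (\<omega> s))) \<omega>, s) *
        ennreal (mag (\<omega> s) powr \<alpha>) \<partial>?M)"
      by (rule palm) measurable
    \<comment> \<open>Since \<open>mag (\<omega> 0) = 1\<close> almost everywhere, the normalised
      function has magnitude \<open>inverse (mag (\<omega> s))\<close> at the origin, and the
      exceedance there turns into \<open>mag (\<omega> s) < u\<close>. This is written with the
      fixed set \<open>{0<..}\<close>, so that joint measurability reduces to that of the
      argument.\<close>
    also have "\<dots> = (\<integral>\<^sup>+(\<omega>, s). g (pscale scl (u / mag (\<omega> s)) \<omega>, s) * indicator {0<..} (u - mag (\<omega> s)) *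
        ennreal (mag (\<omega> s) powr \<alpha>) \<partial>?M)"
    proof (rule nn_integral_cong_AE, use AE_Rlam_mag_0 in eventually_elim)
      fix x :: "('g \<Rightarrow> 'h) \<times> 'g"
      assume 1: "mag (fst x 0) = 1"
      obtain \<omega> s where x: "x = (\<omega>, s)" by (cases x)
      show "(case x of (\<omega>, s) \<Rightarrow> ?g (pscale scl (inverse (mag (\<omega> s))) \<omega>, s) * ennreal (mag (\<omega> s) powr \<alpha>)) =
        (case x of (\<omega>, s) \<Rightarrow> g (pscale scl (u / mag (\<omega> s)) \<omega>, s) * indicator {0<..} (u - mag (\<omega> s)) *
          ennreal (mag (\<omega> s) powr \<alpha>))"
      \<comment> \<open>At magnitude zero both sides vanish because
        \<open>0 powr \<alpha> = 0\<close>, whatever value \<open>pscale\<close> and division take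
        there.\<close>
      proof (cases "mag (\<omega> s) = 0")
        case False
        then have "0 < mag (\<omega> s)" using mag_nonneg[of "\<omega> s"] by simp
        then show ?thesis using u 1
          by (auto simp: x pscale_pscale mag_pscale divide_inverse[symmetric] split: split_indicator)
      qed (simp add: x)
    qed
    finally show ?thesis .
  qed
  have "(\<integral>\<^sup>+u. \<integral>\<^sup>+(\<omega>, s). g (pscale scl u (shift s \<omega>), - s) * indicator {1<..} (u * mag (\<omega> s)) \<partial>?M \<partial>pareto \<alpha>) =
      (\<integral>\<^sup>+u. \<integral>\<^sup>+(\<omega>, s). g (pscale scl (u / mag (\<omega> s)) \<omega>, s) * indicator {0<..} (u - mag (\<omega> s)) *
        ennreal (mag (\<omega> s) powr \<alpha>) \<partial>?M \<partial>pareto \<alpha>)"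
    by (rule nn_integral_cong_AE, use AE_pareto_gt_1[of \<alpha>] in eventually_elim) (rule fixed)
  also have "\<dots> = (\<integral>\<^sup>+x. \<integral>\<^sup>+u. (case x of (\<omega>, s) \<Rightarrow> g (pscale scl (u / mag (\<omega> s)) \<omega>, s) *
      indicator {0<..} (u - mag (\<omega> s)) * ennreal (mag (\<omega> s) powr \<alpha>)) \<partial>pareto \<alpha> \<partial>?M)"
    by (rule PRlam.Fubini'[symmetric]) measurable
  also have "\<dots> = (\<integral>\<^sup>+x. \<integral>\<^sup>+u. (case x of (\<omega>, s) \<Rightarrow> g (pscale scl u \<omega>, s) *
      indicator {1<..} (u * mag (\<omega> s))) \<partial>pareto \<alpha> \<partial>?M)"
  proof (rule nn_integral_cong)
    fix x assume x': "x \<in> space ?M"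
    obtain \<omega> s where x: "x = (\<omega>, s)" by (cases x)
    have [measurable]: "\<omega> \<in> space MF" using x' by (simp add: x space_pair_measure space_R)
    let ?f = "\<lambda>v. g (pscale scl v \<omega>, s)"
    have f: "?f \<in> borel_measurable borel" by measurable
    show "(\<integral>\<^sup>+u. (case x of (\<omega>, s) \<Rightarrow> g (pscale scl (u / mag (\<omega> s)) \<omega>, s) *
        indicator {0<..} (u - mag (\<omega> s)) * ennreal (mag (\<omega> s) powr \<alpha>)) \<partial>pareto \<alpha>) =
      (\<integral>\<^sup>+u. (case x of (\<omega>, s) \<Rightarrow> g (pscale scl u \<omega>, s) * indicator {1<..} (u * mag (\<omega> s))) \<partial>pareto \<alpha>)"
    \<comment> \<open>At magnitude zero the left side carries the factor
      \<open>0 powr \<alpha>\<close>, and on the right there is no exceedance.\<close>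
    proof (cases "mag (\<omega> s) = 0")
      case False
      then have m: "0 < mag (\<omega> s)" using mag_nonneg[of "\<omega> s"] by simp
      have "(\<integral>\<^sup>+u. ?f (u / mag (\<omega> s)) * indicator {0<..} (u - mag (\<omega> s)) * ennreal (mag (\<omega> s) powr \<alpha>) \<partial>pareto \<alpha>) =
          (\<integral>\<^sup>+u. ?f (u / mag (\<omega> s)) * indicator {0<..} (u - mag (\<omega> s)) \<partial>pareto \<alpha>) * ennreal (mag (\<omega> s) powr \<alpha>)"
        by (rule nn_integral_multc) measurable
      also have "\<dots> = (\<integral>\<^sup>+u. ?f u * indicator {1<..} (u * mag (\<omega> s)) \<partial>pareto \<alpha>)"
        using nn_integral_pareto_rescale[OF f m] by (simp add: indicator_def)
      finally show ?thesis by (simp add: x)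
    qed (simp add: x)
  qed
  also have "\<dots> = (\<integral>\<^sup>+u. \<integral>\<^sup>+(\<omega>, s). g (pscale scl u \<omega>, s) * indicator {1<..} (u * mag (\<omega> s)) \<partial>?M \<partial>pareto \<alpha>)"
    by (rule PRlam.Fubini') measurable
  finally show ?thesis .
qed

section \<open>Truncated Pareto integrals, and from exceedances back to the identity for
  \<open>W\<close>\<close>

text \<open>The factor \<open>r powr \<alpha>\<close> compensates the decay of the tail probability
  at level \<open>r\<close>. The constant \<open>c\<close> stands for the part of the integrand that
  does not involve the scale.\<close>

lemma nn_integral_powr_tail:
  assumes "0 < r"
  shows "(\<integral>\<^sup>+u. c * ennreal (r powr \<alpha>) * indicator {a<..} u \<partial>pareto \<alpha>) =
    c * ennreal ((r / max 1 a) powr \<alpha>)"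
proof -
  have "r powr \<alpha> * max 1 a powr - \<alpha> = (r / max 1 a) powr \<alpha>"
    using assms by (simp add: powr_divide powr_minus_divide)
  then show ?thesis
    by (simp add: nn_integral_cmult emeasure_pareto_greaterThan alpha_pos mult.assoc ennreal_mult'[symmetric])
qed

text \<open>For positive \<open>m\<close> the two constraints amount to the single threshold
  \<open>max r (1 / m)\<close>. As \<open>r\<close> grows, the resulting weight increases to the
  indicator of \<open>m > 0\<close>, the weight on the left of the identity for
  \<open>W\<close>.\<close>

lemma nn_integral_both_tails:
  assumes "1 \<le> r" "0 \<le> m"
  shows "(\<integral>\<^sup>+u. c * ennreal (r powr \<alpha>) * (indicator {r<..} u * indicator {1<..} (u * m)) \<partial>pareto \<alpha>) =
    c * ennreal (min 1 (r * m) powr \<alpha>)"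
proof (cases "m = 0")
  case False
  then have "0 < m" using assms by simp
  have "(\<integral>\<^sup>+u. c * ennreal (r powr \<alpha>) * (indicator {r<..} u * indicator {1<..} (u * m)) \<partial>pareto \<alpha>) =
      (\<integral>\<^sup>+u. c * ennreal (r powr \<alpha>) * indicator {max r (1 / m)<..} u \<partial>pareto \<alpha>)"
    using \<open>0 < m\<close> by (intro nn_integral_cong) (auto simp: field_simps split: split_indicator)
  also have "\<dots> = c * ennreal ((r / max 1 (max r (1 / m))) powr \<alpha>)"
    using assms by (intro nn_integral_powr_tail) simp
  also have "r / max 1 (max r (1 / m)) = min 1 (r * m)"
  proof (cases "1 \<le> r * m")
    case True
    then have "1 / m \<le> r" using \<open>0 < m\<close> by (simp add: field_simps)
    then show ?thesis using True assms by simp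
  next
    case False
    then have "r < 1 / m" using \<open>0 < m\<close> by (simp add: field_simps)
    then show ?thesis using False assms by simp
  qed
  finally show ?thesis .
qed simp

text \<open>As \<open>1 \<le> r\<close>, the constraint at level \<open>r\<close> implies the one at
  level 1, and for positive \<open>m\<close> only the threshold \<open>r / m\<close> remains. As
  \<open>r\<close> grows, the weight increases to \<open>m powr \<alpha>\<close>, the weight on the
  right of the identity for \<open>W\<close>.\<close>

lemma nn_integral_scaled_tails:
  assumes "1 \<le> r" "0 \<le> m"
  shows "(\<integral>\<^sup>+u. c * ennreal (r powr \<alpha>) * (indicator {r<..} (u * m) * indicator {1<..} (u * m)) \<partial>pareto \<alpha>) =
    c * ennreal (min r m powr \<alpha>)"
proof (cases "m = 0")
  case False
  then have "0 < m" using assms by simp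
  have "(\<integral>\<^sup>+u. c * ennreal (r powr \<alpha>) * (indicator {r<..} (u * m) * indicator {1<..} (u * m)) \<partial>pareto \<alpha>) =
      (\<integral>\<^sup>+u. c * ennreal (r powr \<alpha>) * indicator {r / m<..} u \<partial>pareto \<alpha>)"
    using \<open>0 < m\<close> \<open>1 \<le> r\<close> by (intro nn_integral_cong) (auto simp: field_simps split: split_indicator)
  also have "\<dots> = c * ennreal ((r / max 1 (r / m)) powr \<alpha>)"
    using assms by (intro nn_integral_powr_tail) simp
  also have "r / max 1 (r / m) = min r m"
    using assms \<open>0 < m\<close> by (auto simp: max_def min_def field_simps)
  finally show ?thesis .
qed (use assms in simp)

text \<open>Idea: testing the hypothesis with functions concentrated on \<open>mag (\<eta> t) > r\<close> and normalised by
  \<open>r powr \<alpha>\<close> gives the claim with \<open>min 1 (r * mag (\<omega> s)) powr \<alpha>\<close> and \<open>min r (mag (\<omega> s)) powr \<alpha>\<close>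
  as weights; then \<open>r\<close> tends to infinity.\<close>

lemma tail_imp_palm:
  fixes g :: "('g \<Rightarrow> 'h) \<times> 'g \<Rightarrow> ennreal"
  assumes tail: "\<And>g :: ('g \<Rightarrow> 'h) \<times> 'g \<Rightarrow> ennreal. g \<in> borel_measurable (MF \<Otimes>\<^sub>M borel) \<Longrightarrow>
      (\<integral>\<^sup>+u. \<integral>\<^sup>+(\<omega>, s). g (pscale scl u (shift s \<omega>), - s) * indicator {1<..} (u * mag (\<omega> s))
        \<partial>(R \<Otimes>\<^sub>M lam) \<partial>pareto \<alpha>) =
      (\<integral>\<^sup>+u. \<integral>\<^sup>+(\<omega>, s). g (pscale scl u \<omega>, s) * indicator {1<..} (u * mag (\<omega> s))
        \<partial>(R \<Otimes>\<^sub>M lam) \<partial>pareto \<alpha>)"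
    and g [measurable]: "g \<in> borel_measurable (MF \<Otimes>\<^sub>M borel)"
  shows "(\<integral>\<^sup>+(\<omega>, s). g (shift s \<omega>, - s) * indicator {0<..} (mag (\<omega> s)) \<partial>(R \<Otimes>\<^sub>M lam)) =
      (\<integral>\<^sup>+(\<omega>, s). g (pscale scl (inverse (mag (\<omega> s))) \<omega>, s) * ennreal (mag (\<omega> s) powr \<alpha>)
        \<partial>(R \<Otimes>\<^sub>M lam))"
proof -
  let ?M = "R \<Otimes>\<^sub>M lam"
  define L where "L r = (\<lambda>(\<omega>, s). g (shift s \<omega>, - s) * ennreal (min 1 (r * mag (\<omega> s)) powr \<alpha>))" for r
  define U where "U r = (\<lambda>(\<omega>, s). g (pscale scl (inverse (mag (\<omega> s))) \<omega>, s) *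
    ennreal (min r (mag (\<omega> s)) powr \<alpha>))" for r
  have [measurable]: "L r \<in> borel_measurable ?M" "U r \<in> borel_measurable ?M" for r
    unfolding L_def U_def by measurable
  have truncated: "(\<integral>\<^sup>+x. L r x \<partial>?M) = (\<integral>\<^sup>+x. U r x \<partial>?M)" if r: "1 \<le> r" for r
  proof -
    \<comment> \<open>Dividing by the magnitude at \<open>t\<close> removes the scale on both sides.
      For the pair \<open>(pscale scl u (shift s \<omega>), - s)\<close> the value at
      \<open>- s\<close> is that of \<open>\<omega> 0\<close> scaled by \<open>u\<close>, of
      magnitude \<open>u\<close>, so \<open>shift s \<omega>\<close> is recovered and the constraint
      is \<open>r < u\<close>. For \<open>(pscale scl u \<omega>, s)\<close> the magnitude is
      \<open>u * mag (\<omega> s)\<close>, which leaves \<open>\<omega>\<close> scaled by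
      \<open>inverse (mag (\<omega> s))\<close>.\<close>
    let ?h = "\<lambda>(\<eta>, t). g (pscale scl (inverse (mag (\<eta> t))) \<eta>, t) * ennreal (r powr \<alpha>) *
      indicator {r<..} (mag (\<eta> t)) :: ennreal"
    \<comment> \<open>The truncated weight is expanded into a Pareto integral, which brings in the
      scale variable of the hypothesis.\<close>
    have "(\<integral>\<^sup>+x. L r x \<partial>?M) = (\<integral>\<^sup>+x. \<integral>\<^sup>+u. (case x of (\<omega>, s) \<Rightarrow> g (shift s \<omega>, - s) * ennreal (r powr \<alpha>) *
        (indicator {r<..} u * indicator {1<..} (u * mag (\<omega> s)))) \<partial>pareto \<alpha> \<partial>?M)"
      by (intro nn_integral_cong)
         (auto simp: L_def nn_integral_both_tails r mag_nonneg simp del: nn_integral_indicator)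
    also have "\<dots> = (\<integral>\<^sup>+u. \<integral>\<^sup>+(\<omega>, s). g (shift s \<omega>, - s) * ennreal (r powr \<alpha>) *
        (indicator {r<..} u * indicator {1<..} (u * mag (\<omega> s))) \<partial>?M \<partial>pareto \<alpha>)"
      by (rule PRlam.Fubini') measurable
    also have "\<dots> = (\<integral>\<^sup>+u. \<integral>\<^sup>+(\<omega>, s). ?h (pscale scl u (shift s \<omega>), - s) * indicator {1<..} (u * mag (\<omega> s))
        \<partial>?M \<partial>pareto \<alpha>)"
    proof (rule nn_integral_cong_AE, use AE_pareto_gt_1[of \<alpha>] in eventually_elim)
      fix u :: real assume u: "1 < u"
      have "AE x in ?M. (case x of (\<omega>, s) \<Rightarrow> g (shift s \<omega>, - s) * ennreal (r powr \<alpha>) *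
          (indicator {r<..} u * indicator {1<..} (u * mag (\<omega> s)))) =
        (case x of (\<omega>, s) \<Rightarrow> ?h (pscale scl u (shift s \<omega>), - s) * indicator {1<..} (u * mag (\<omega> s)))"
        using AE_Rlam_mag_0
      proof eventually_elim
        fix x :: "('g \<Rightarrow> 'h) \<times> 'g"
        assume 1: "mag (fst x 0) = 1"
        obtain \<omega> s where x: "x = (\<omega>, s)" by (cases x)
        have "mag (pscale scl u (shift s \<omega>) (- s)) = u"
          using u 1 by (simp add: x mag_pscale shift_def)
        then show "(case x of (\<omega>, s) \<Rightarrow> g (shift s \<omega>, - s) * ennreal (r powr \<alpha>) *
          (indicator {r<..} u * indicator {1<..} (u * mag (\<omega> s)))) =
        (case x of (\<omega>, s) \<Rightarrow> ?h (pscale scl u (shift s \<omega>), - s) * indicator {1<..} (u * mag (\<omega> s)))"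
          using u by (simp add: x pscale_pscale pscale_one mult.assoc)
      qed
      then show "(\<integral>\<^sup>+(\<omega>, s). g (shift s \<omega>, - s) * ennreal (r powr \<alpha>) *
          (indicator {r<..} u * indicator {1<..} (u * mag (\<omega> s))) \<partial>?M) =
        (\<integral>\<^sup>+(\<omega>, s). ?h (pscale scl u (shift s \<omega>), - s) * indicator {1<..} (u * mag (\<omega> s)) \<partial>?M)"
        by (rule nn_integral_cong_AE)
    qed
    also have "\<dots> = (\<integral>\<^sup>+u. \<integral>\<^sup>+(\<omega>, s). ?h (pscale scl u \<omega>, s) * indicator {1<..} (u * mag (\<omega> s))
        \<partial>?M \<partial>pareto \<alpha>)"
      by (rule tail) measurable
    also have "\<dots> = (\<integral>\<^sup>+u. \<integral>\<^sup>+(\<omega>, s). g (pscale scl (inverse (mag (\<omega> s))) \<omega>, s) * ennreal (r powr \<alpha>) *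
        (indicator {r<..} (u * mag (\<omega> s)) * indicator {1<..} (u * mag (\<omega> s))) \<partial>?M \<partial>pareto \<alpha>)"
    proof (rule nn_integral_cong_AE, use AE_pareto_gt_1[of \<alpha>] in eventually_elim,
        intro nn_integral_cong)
      fix u :: real and x :: "('g \<Rightarrow> 'h) \<times> 'g" assume u: "1 < u"
      obtain \<omega> s where x: "x = (\<omega>, s)" by (cases x)
      show "(case x of (\<omega>, s) \<Rightarrow> ?h (pscale scl u \<omega>, s) * indicator {1<..} (u * mag (\<omega> s))) =
        (case x of (\<omega>, s) \<Rightarrow> g (pscale scl (inverse (mag (\<omega> s))) \<omega>, s) * ennreal (r powr \<alpha>) *
          (indicator {r<..} (u * mag (\<omega> s)) * indicator {1<..} (u * mag (\<omega> s))))"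
      proof (cases "mag (\<omega> s) = 0")
        case False
        then have "0 < mag (\<omega> s)" using mag_nonneg[of "\<omega> s"] by simp
        moreover have eq: "inverse u * (inverse (mag (\<omega> s)) * u) = inverse (mag (\<omega> s))" using u by simp
        ultimately show ?thesis using u by (simp add: x mag_pscale pscale_pscale mult.assoc eq)
      qed (simp add: x)
    qed
    also have "\<dots> = (\<integral>\<^sup>+x. \<integral>\<^sup>+u. (case x of (\<omega>, s) \<Rightarrow> g (pscale scl (inverse (mag (\<omega> s))) \<omega>, s) *
        ennreal (r powr \<alpha>) * (indicator {r<..} (u * mag (\<omega> s)) * indicator {1<..} (u * mag (\<omega> s))))
        \<partial>pareto \<alpha> \<partial>?M)"
      by (rule PRlam.Fubini'[symmetric]) measurable
    also have "\<dots> = (\<integral>\<^sup>+x. U r x \<partial>?M)"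
      by (intro nn_integral_cong)
         (auto simp: U_def nn_integral_scaled_tails r mag_nonneg simp del: nn_integral_indicator)
    finally show ?thesis .
  qed
  \<comment> \<open>The levels are \<open>Suc n\<close> so that each satisfies
    \<open>1 \<le> r\<close>, as the truncated identity requires. For fixed \<open>\<omega>\<close>
    and \<open>s\<close> the weight is eventually equal to its limit, so pointwise convergence is
    immediate.\<close>
  have L_lim: "(\<lambda>n. \<integral>\<^sup>+x. L (real (Suc n)) x \<partial>?M) \<longlonglongrightarrow>
      (\<integral>\<^sup>+(\<omega>, s). g (shift s \<omega>, - s) * indicator {0<..} (mag (\<omega> s)) \<partial>?M)"
  proof (rule nn_integral_LIMSEQ)
    show "incseq (\<lambda>n. L (real (Suc n)))"
      using alpha_pos mag_nonneg
      by (auto simp: L_def incseq_def le_fun_def intro!: mult_left_mono ennreal_leI powr_mono2 min.mono mult_right_mono)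
    fix x :: "('g \<Rightarrow> 'h) \<times> 'g"
    obtain \<omega> s where x: "x = (\<omega>, s)" by (cases x)
    show "(\<lambda>n. L (real (Suc n)) x) \<longlonglongrightarrow> (case x of (\<omega>, s) \<Rightarrow> g (shift s \<omega>, - s) * indicator {0<..} (mag (\<omega> s)))"
    proof (cases "mag (\<omega> s) = 0")
      case False
      then have m: "0 < mag (\<omega> s)" using mag_nonneg[of "\<omega> s"] by simp
      have "\<forall>\<^sub>F n in sequentially. 1 \<le> real (Suc n) * mag (\<omega> s)"
        using m by real_asymp
      then show ?thesis
        using m by (intro tendsto_eventually) (auto elim!: eventually_mono simp: x L_def min_absorb1)
    qed (simp add: x L_def)
  qed measurable
  have U_lim: "(\<lambda>n. \<integral>\<^sup>+x. U (real (Suc n)) x \<partial>?M) \<longlonglongrightarrow>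
      (\<integral>\<^sup>+(\<omega>, s). g (pscale scl (inverse (mag (\<omega> s))) \<omega>, s) * ennreal (mag (\<omega> s) powr \<alpha>) \<partial>?M)"
  proof (rule nn_integral_LIMSEQ)
    show "incseq (\<lambda>n. U (real (Suc n)))"
      using alpha_pos mag_nonneg
      by (auto simp: U_def incseq_def le_fun_def intro!: mult_left_mono ennreal_leI powr_mono2 min.mono)
    fix x :: "('g \<Rightarrow> 'h) \<times> 'g"
    obtain \<omega> s where x: "x = (\<omega>, s)" by (cases x)
    have "\<forall>\<^sub>F n in sequentially. mag (\<omega> s) \<le> real (Suc n)"
      by real_asymp
    then show "(\<lambda>n. U (real (Suc n)) x) \<longlonglongrightarrow> (case x of (\<omega>, s) \<Rightarrow>
        g (pscale scl (inverse (mag (\<omega> s))) \<omega>, s) * ennreal (mag (\<omega> s) powr \<alpha>))"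
      by (intro tendsto_eventually) (auto elim!: eventually_mono simp: x U_def min_absorb2)
  qed measurable
  show ?thesis
    using LIMSEQ_unique[OF L_lim] U_lim truncated by simp
qed

section \<open>The law built from \<open>R\<close>, and integrals of \<open>W\<close> and of the
  exceedance measure\<close>

text \<open>The law of a function drawn from \<open>R\<close> and multiplied by an independent
  Pareto scale. As an image measure it turns integrals into iterated integrals directly.\<close>

definition Q :: "('g \<Rightarrow> 'h) measure"
  where "Q = distr (pareto \<alpha> \<Otimes>\<^sub>M R) MF (\<lambda>(u, \<omega>). pscale scl u \<omega>)"

lemma nn_integral_Q:
  assumes [measurable]: "f \<in> borel_measurable MF"
  shows "(\<integral>\<^sup>+\<omega>. f \<omega> \<partial>Q) = (\<integral>\<^sup>+u. \<integral>\<^sup>+\<omega>. f (pscale scl u \<omega>) \<partial>R \<partial>pareto \<alpha>)"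
  unfolding Q_def by (subst nn_integral_distr) (auto simp: R.nn_integral_fst[symmetric])

text \<open>The spectral decomposition prescribes the measure of every set and so determines the
  law. The indicator of \<open>{1<..}\<close> confines the integral to positive scalars, where
  \<open>pscale\<close> and \<open>scale_fun\<close> agree.\<close>

lemma Q_eqI:
  assumes "sets N = sets MF"
    and N: "\<And>A. A \<in> sets MF \<Longrightarrow> emeasure N A =
        (\<integral>\<^sup>+u. (\<integral>\<^sup>+\<omega>. indicator A (scale_fun scl u \<omega>) * indicator {1<..} u
          * ennreal (\<alpha> * u powr (- \<alpha> - 1)) \<partial>R) \<partial>lborel)"
  shows "N = Q"
proof (rule measure_eqI)
  show "sets N = sets Q" using assms by (simp add: Q_def)
  fix A assume "A \<in> sets N"
  then have [measurable]: "A \<in> sets MF" using assms by simp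
  have "emeasure Q A = (\<integral>\<^sup>+\<omega>. indicator A \<omega> \<partial>Q)" by (simp add: Q_def)
  also have "\<dots> = (\<integral>\<^sup>+u. \<integral>\<^sup>+\<omega>. indicator A (pscale scl u \<omega>) \<partial>R \<partial>pareto \<alpha>)"
    by (rule nn_integral_Q) measurable
  also have "\<dots> = (\<integral>\<^sup>+u. indicator {1<..} u * ennreal (\<alpha> * u powr (- \<alpha> - 1)) *
      (\<integral>\<^sup>+\<omega>. indicator A (pscale scl u \<omega>) \<partial>R) \<partial>lborel)"
    by (rule nn_integral_pareto) measurable
  also have "\<dots> = (\<integral>\<^sup>+u. (\<integral>\<^sup>+\<omega>. indicator A (scale_fun scl u \<omega>) * indicator {1<..} u
          * ennreal (\<alpha> * u powr (- \<alpha> - 1)) \<partial>R) \<partial>lborel)"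
  proof (rule nn_integral_cong)
    fix u :: real
    have "indicator {1<..} u * ennreal (\<alpha> * u powr (- \<alpha> - 1)) * (\<integral>\<^sup>+\<omega>. indicator A (pscale scl u \<omega>) \<partial>R) =
      (\<integral>\<^sup>+\<omega>. indicator {1<..} u * ennreal (\<alpha> * u powr (- \<alpha> - 1)) * indicator A (pscale scl u \<omega>) \<partial>R)"
      by (rule nn_integral_cmult[symmetric]) measurable
    also have "\<dots> = (\<integral>\<^sup>+\<omega>. indicator A (scale_fun scl u \<omega>) * indicator {1<..} u
          * ennreal (\<alpha> * u powr (- \<alpha> - 1)) \<partial>R)"
      by (intro nn_integral_cong) (auto simp: pscale_pos mult.commute split: split_indicator)
    finally show "indicator {1<..} u * ennreal (\<alpha> * u powr (- \<alpha> - 1)) * (\<integral>\<^sup>+\<omega>. indicator A (pscale scl u \<omega>) \<partial>R) =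
      (\<integral>\<^sup>+\<omega>. indicator A (scale_fun scl u \<omega>) * indicator {1<..} u
          * ennreal (\<alpha> * u powr (- \<alpha> - 1)) \<partial>R)" .
  qed
  finally show "emeasure N A = emeasure Q A" using N by simp
qed

text \<open>Almost surely the magnitude at the origin is the Pareto scale itself, because functions
  drawn from \<open>R\<close> have magnitude 1 there.\<close>

lemma AE_Q_mag_0: "AE \<omega> in Q. 0 < mag (\<omega> 0)"
proof -
  interpret PR: pair_sigma_finite "pareto \<alpha>" R ..
  have "AE x in pareto \<alpha> \<Otimes>\<^sub>M R. 0 < mag ((case x of (u, \<omega>) \<Rightarrow> pscale scl u \<omega>) 0)"
  proof (rule PR.AE_pair_measure)
    show "AE u in pareto \<alpha>. AE \<omega> in R. 0 < mag ((case (u, \<omega>) of (u, \<omega>) \<Rightarrow> pscale scl u \<omega>) 0)"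
      using AE_pareto_gt_1[of \<alpha>] AE_mag_0 by (auto elim!: eventually_mono simp: mag_pscale)
  qed measurable
  then show ?thesis
    unfolding Q_def by (subst AE_distr_iff) auto
qed

text \<open>Where \<open>mag (\<omega> 0)\<close> vanishes, \<open>W scl mag x0 \<omega>\<close> is a constant function that need not lie in
  \<open>space MF\<close>; this only happens on a null set.\<close>

lemma nn_integral_Q_W:
  assumes [measurable]: "f \<in> borel_measurable MF"
  shows "(\<integral>\<^sup>+\<omega>. f (W scl mag x0 \<omega>) \<partial>Q) = (\<integral>\<^sup>+\<omega>. f \<omega> \<partial>R)"
proof -
  let ?N = "\<lambda>\<omega> :: 'g \<Rightarrow> 'h. pscale scl (inverse (mag (\<omega> 0))) \<omega>"
  have "(\<integral>\<^sup>+\<omega>. f (W scl mag x0 \<omega>) \<partial>Q) = (\<integral>\<^sup>+\<omega>. f (?N \<omega>) \<partial>Q)"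
    by (rule nn_integral_cong_AE, use AE_Q_mag_0 in eventually_elim)
       (simp add: W_def pscale_def scale_fun_def)
  also have "\<dots> = (\<integral>\<^sup>+u. \<integral>\<^sup>+\<omega>. f (?N (pscale scl u \<omega>)) \<partial>R \<partial>pareto \<alpha>)"
    by (rule nn_integral_Q) measurable
  \<comment> \<open>Normalising \<open>pscale scl u \<omega>\<close> divides by \<open>u * 1\<close>
    and returns \<open>\<omega>\<close>, so the inner integral does not depend on \<open>u\<close>,
    and the Pareto law has total mass 1. Thus \<open>W\<close> has law \<open>R\<close>.\<close>
  also have "\<dots> = (\<integral>\<^sup>+u. \<integral>\<^sup>+\<omega>. f \<omega> \<partial>R \<partial>pareto \<alpha>)"
  proof (rule nn_integral_cong_AE, use AE_pareto_gt_1[of \<alpha>] in eventually_elim)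
    fix u :: real assume "1 < u"
    then show "(\<integral>\<^sup>+\<omega>. f (?N (pscale scl u \<omega>)) \<partial>R) = (\<integral>\<^sup>+\<omega>. f \<omega> \<partial>R)"
      by (intro nn_integral_cong_AE, use AE_mag_0 in eventually_elim)
         (simp add: mag_pscale pscale_pscale pscale_one)
  qed
  also have "\<dots> = (\<integral>\<^sup>+\<omega>. f \<omega> \<partial>R)"
    using P.emeasure_space_1 by simp
  finally show ?thesis .
qed

lemma nn_integral_Rlam:
  assumes [measurable]: "case_prod f \<in> borel_measurable (MF \<Otimes>\<^sub>M borel)"
  shows "(\<integral>\<^sup>+(\<omega>, s). f \<omega> s \<partial>(R \<Otimes>\<^sub>M lam)) = (\<integral>\<^sup>+\<omega>. \<integral>\<^sup>+s. f \<omega> s \<partial>lam \<partial>R)"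
  by (subst lam.nn_integral_fst[symmetric]) simp_all

text \<open>For a function \<open>\<omega>\<close> scaled by \<open>u\<close> the exceedance set is
  where \<open>1 < u * mag (\<omega> s)\<close>. Both sides of mass-stationarity are integrals of
  this form.\<close>

lemma nn_integral_Q_exceedance:
  assumes [measurable]: "case_prod f \<in> borel_measurable (MF \<Otimes>\<^sub>M borel)"
  shows "(\<integral>\<^sup>+\<omega>. \<integral>\<^sup>+s. f \<omega> s \<partial>exceedance lam mag \<omega> \<partial>Q) =
    (\<integral>\<^sup>+u. \<integral>\<^sup>+(\<omega>, s). f (pscale scl u \<omega>) s * indicator {1<..} (u * mag (\<omega> s)) \<partial>(R \<Otimes>\<^sub>M lam) \<partial>pareto \<alpha>)"
proof -
  have "(\<integral>\<^sup>+\<omega>. \<integral>\<^sup>+s. f \<omega> s \<partial>exceedance lam mag \<omega> \<partial>Q) =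
      (\<integral>\<^sup>+\<omega>. \<integral>\<^sup>+s. f \<omega> s * indicator {1<..} (mag (\<omega> s)) \<partial>lam \<partial>Q)"
  proof (rule nn_integral_cong)
    fix \<omega> assume "\<omega> \<in> space Q"
    then have [measurable]: "\<omega> \<in> space MF" by (simp add: Q_def)
    have [measurable]: "{s. 1 < mag (\<omega> s)} \<in> sets borel" by measurable
    show "(\<integral>\<^sup>+s. f \<omega> s \<partial>exceedance lam mag \<omega>) = (\<integral>\<^sup>+s. f \<omega> s * indicator {1<..} (mag (\<omega> s)) \<partial>lam)"
      unfolding exceedance_def
      by (subst nn_integral_density) (auto simp: indicator_def mult.commute intro!: nn_integral_cong)
  qed
  also have "\<dots> = (\<integral>\<^sup>+u. \<integral>\<^sup>+\<omega>. \<integral>\<^sup>+s. f (pscale scl u \<omega>) s * indicator {1<..} (mag (pscale scl u \<omega> s))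
      \<partial>lam \<partial>R \<partial>pareto \<alpha>)"
    by (rule nn_integral_Q) measurable
  also have "\<dots> = (\<integral>\<^sup>+u. \<integral>\<^sup>+(\<omega>, s). f (pscale scl u \<omega>) s * indicator {1<..} (u * mag (\<omega> s)) \<partial>(R \<Otimes>\<^sub>M lam) \<partial>pareto \<alpha>)"
  proof (rule nn_integral_cong_AE, use AE_pareto_gt_1[of \<alpha>] in eventually_elim)
    fix u :: real assume "1 < u"
    then show "(\<integral>\<^sup>+\<omega>. \<integral>\<^sup>+s. f (pscale scl u \<omega>) s * indicator {1<..} (mag (pscale scl u \<omega> s)) \<partial>lam \<partial>R) =
      (\<integral>\<^sup>+(\<omega>, s). f (pscale scl u \<omega>) s * indicator {1<..} (u * mag (\<omega> s)) \<partial>(R \<Otimes>\<^sub>M lam))"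
      by (subst nn_integral_Rlam) (auto simp: mag_pscale)
  qed
  finally show ?thesis .
qed

end

section \<open>Rewriting both conditions in terms of the Pareto law, \<open>R\<close> and
  \<open>lam\<close>\<close>

theorem theorem5p2:
  fixes lam :: "'g::{topological_ab_group_add, second_countable_topology, t2_space} measure"
    and scl :: "real \<Rightarrow> 'h::polish_space \<Rightarrow> 'h"
    and mag :: "'h \<Rightarrow> real"
    and x0 :: 'h
    and MF Q :: "('g \<Rightarrow> 'h) measure"
    and \<alpha> :: real
  assumes "cone_valued_functions lam scl mag x0 MF"
    and "prob_space Q" and "sets Q = sets MF"
    and "\<alpha> > 0" and "spectrally_decomposable scl mag MF \<alpha> Q"
  shows "mass_stationary MF Q (exceedance lam mag) \<longleftrightarrow>
    (\<forall>g::('g \<Rightarrow> 'h) \<times> 'g \<Rightarrow> ennreal. g \<in> borel_measurable (MF \<Otimes>\<^sub>M borel) \<longrightarrow>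
      (\<integral>\<^sup>+\<omega>. (\<integral>\<^sup>+s. g (shift s (W scl mag x0 \<omega>), - s)
          * indicator {s. mag (W scl mag x0 \<omega> s) > 0} s \<partial>lam) \<partial>Q)
      = (\<integral>\<^sup>+\<omega>. (\<integral>\<^sup>+s.
          (if mag (W scl mag x0 \<omega> s) = 0 then 0
           else g (scale_fun scl (inverse (mag (W scl mag x0 \<omega> s))) (W scl mag x0 \<omega>), s)
             * ennreal (mag (W scl mag x0 \<omega> s) powr \<alpha>)) \<partial>lam) \<partial>Q))"
proof -
  interpret cone_valued_functions lam scl mag x0 MF by fact
  obtain R where R: "prob_space R" "sets R = sets MF"
      "emeasure R {\<omega> \<in> space MF. mag (\<omega> 0) = 1} = 1"
    and Q: "\<And>A. A \<in> sets MF \<Longrightarrow> emeasure Q A =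
        (\<integral>\<^sup>+u. (\<integral>\<^sup>+\<omega>. indicator A (scale_fun scl u \<omega>) * indicator {1<..} u
          * ennreal (\<alpha> * u powr (- \<alpha> - 1)) \<partial>R) \<partial>lborel)"
    using assms(5) unfolding spectrally_decomposable_def by blast
  interpret R: prob_space R by fact
  note R(2) [measurable_cong]
  have "AE \<omega> in R. mag (\<omega> 0) = 1"
  proof -
    have "{\<omega> \<in> space MF. mag (\<omega> 0) = 1} \<in> sets MF" by measurable
    then show ?thesis
      using R.AE_in_set_eq_1[of "{\<omega> \<in> space MF. mag (\<omega> 0) = 1}"] R(2,3)
      by (auto simp: R.emeasure_eq_measure elim!: eventually_mono)
  qed
  then interpret S: spectral_measure lam scl mag x0 MF R \<alpha>
    using R(2) assms(4) by unfold_locales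
  have Q_eq: "Q = S.Q"
    using assms(3) Q by (rule S.Q_eqI)
  let ?M = "R \<Otimes>\<^sub>M lam"
  \<comment> \<open>Shifting commutes with scaling, so the shifted integrand also takes the form
    required by the two implications.\<close>
  have stationary: "mass_stationary MF Q (exceedance lam mag) \<longleftrightarrow>
    (\<forall>g::('g \<Rightarrow> 'h) \<times> 'g \<Rightarrow> ennreal. g \<in> borel_measurable (MF \<Otimes>\<^sub>M borel) \<longrightarrow>
      (\<integral>\<^sup>+u. \<integral>\<^sup>+(\<omega>, s). g (pscale scl u (shift s \<omega>), - s) * indicator {1<..} (u * mag (\<omega> s)) \<partial>?M \<partial>pareto \<alpha>) =
      (\<integral>\<^sup>+u. \<integral>\<^sup>+(\<omega>, s). g (pscale scl u \<omega>, s) * indicator {1<..} (u * mag (\<omega> s)) \<partial>?M \<partial>pareto \<alpha>))"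
    unfolding mass_stationary_def Q_eq
    by (intro all_cong1 imp_cong refl arg_cong2[where f = "(=)"])
       (simp_all add: S.nn_integral_Q_exceedance shift_pscale)
  have palm_left: "(\<integral>\<^sup>+\<omega>. (\<integral>\<^sup>+s. g (shift s (W scl mag x0 \<omega>), - s)
        * indicator {s. mag (W scl mag x0 \<omega> s) > 0} s \<partial>lam) \<partial>Q) =
      (\<integral>\<^sup>+(\<omega>, s). g (shift s \<omega>, - s) * indicator {0<..} (mag (\<omega> s)) \<partial>?M)"
    if [measurable]: "g \<in> borel_measurable (MF \<Otimes>\<^sub>M borel)" for g :: "('g \<Rightarrow> 'h) \<times> 'g \<Rightarrow> ennreal"
  proof -
    \<comment> \<open>The integrand is exhibited as a function of
      \<open>W scl mag x0 \<omega>\<close> alone, so that passing from \<open>Q\<close> to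
      \<open>R\<close> replaces \<open>W\<close> by the identity.\<close>
    have "(\<integral>\<^sup>+\<omega>. (\<integral>\<^sup>+s. g (shift s (W scl mag x0 \<omega>), - s)
        * indicator {s. mag (W scl mag x0 \<omega> s) > 0} s \<partial>lam) \<partial>Q) =
      (\<integral>\<^sup>+\<omega>. (\<lambda>\<omega>. \<integral>\<^sup>+s. g (shift s \<omega>, - s) * indicator {0<..} (mag (\<omega> s)) \<partial>lam) (W scl mag x0 \<omega>) \<partial>Q)"
      by (simp add: indicator_def)
    also have "\<dots> = (\<integral>\<^sup>+\<omega>. \<integral>\<^sup>+s. g (shift s \<omega>, - s) * indicator {0<..} (mag (\<omega> s)) \<partial>lam \<partial>R)"
      unfolding Q_eq by (rule S.nn_integral_Q_W) measurable
    finally show ?thesis by (simp add: S.nn_integral_Rlam)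
  qed
  have palm_right: "(\<integral>\<^sup>+\<omega>. (\<integral>\<^sup>+s. (if mag (W scl mag x0 \<omega> s) = 0 then 0
        else g (scale_fun scl (inverse (mag (W scl mag x0 \<omega> s))) (W scl mag x0 \<omega>), s)
          * ennreal (mag (W scl mag x0 \<omega> s) powr \<alpha>)) \<partial>lam) \<partial>Q) =
      (\<integral>\<^sup>+(\<omega>, s). g (pscale scl (inverse (mag (\<omega> s))) \<omega>, s) * ennreal (mag (\<omega> s) powr \<alpha>) \<partial>?M)"
    if [measurable]: "g \<in> borel_measurable (MF \<Otimes>\<^sub>M borel)" for g :: "('g \<Rightarrow> 'h) \<times> 'g \<Rightarrow> ennreal"
  proof -
    \<comment> \<open>The convention that terms with magnitude zero vanish is already built into
      \<open>0 powr \<alpha> = 0\<close>; elsewhere the scalar is positive and \<open>pscale\<close>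
      is the given scaling.\<close>
    have "(if mag (\<omega> s) = 0 then 0 else g (scale_fun scl (inverse (mag (\<omega> s))) \<omega>, s)
          * ennreal (mag (\<omega> s) powr \<alpha>)) =
        g (pscale scl (inverse (mag (\<omega> s))) \<omega>, s) * ennreal (mag (\<omega> s) powr \<alpha>)"
      for \<omega> :: "'g \<Rightarrow> 'h" and s
      using mag_nonneg[of "\<omega> s"] by (auto simp: pscale_pos)
    then have "(\<integral>\<^sup>+\<omega>. (\<integral>\<^sup>+s. (if mag (W scl mag x0 \<omega> s) = 0 then 0
        else g (scale_fun scl (inverse (mag (W scl mag x0 \<omega> s))) (W scl mag x0 \<omega>), s)
          * ennreal (mag (W scl mag x0 \<omega> s) powr \<alpha>)) \<partial>lam) \<partial>Q) =
      (\<integral>\<^sup>+\<omega>. (\<lambda>\<omega>. \<integral>\<^sup>+s. g (pscale scl (inverse (mag (\<omega> s))) \<omega>, s) * ennreal (mag (\<omega> s) powr \<alpha>) \<partial>lam)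
        (W scl mag x0 \<omega>) \<partial>Q)"
      by simp
    also have "\<dots> = (\<integral>\<^sup>+\<omega>. \<integral>\<^sup>+s. g (pscale scl (inverse (mag (\<omega> s))) \<omega>, s) *
        ennreal (mag (\<omega> s) powr \<alpha>) \<partial>lam \<partial>R)"
      unfolding Q_eq by (rule S.nn_integral_Q_W) measurable
    finally show ?thesis by (simp add: S.nn_integral_Rlam)
  qed
  show ?thesis
    unfolding stationary
  proof (intro iffI allI impI)
    fix g :: "('g \<Rightarrow> 'h) \<times> 'g \<Rightarrow> ennreal"
    assume tail: "\<forall>g::('g \<Rightarrow> 'h) \<times> 'g \<Rightarrow> ennreal. g \<in> borel_measurable (MF \<Otimes>\<^sub>M borel) \<longrightarrow>
      (\<integral>\<^sup>+u. \<integral>\<^sup>+(\<omega>, s). g (pscale scl u (shift s \<omega>), - s) * indicator {1<..} (u * mag (\<omega> s)) \<partial>?M \<partial>pareto \<alpha>) =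
      (\<integral>\<^sup>+u. \<integral>\<^sup>+(\<omega>, s). g (pscale scl u \<omega>, s) * indicator {1<..} (u * mag (\<omega> s)) \<partial>?M \<partial>pareto \<alpha>)"
      and g: "g \<in> borel_measurable (MF \<Otimes>\<^sub>M borel)"
    show "(\<integral>\<^sup>+\<omega>. (\<integral>\<^sup>+s. g (shift s (W scl mag x0 \<omega>), - s)
          * indicator {s. mag (W scl mag x0 \<omega> s) > 0} s \<partial>lam) \<partial>Q)
      = (\<integral>\<^sup>+\<omega>. (\<integral>\<^sup>+s.
          (if mag (W scl mag x0 \<omega> s) = 0 then 0
           else g (scale_fun scl (inverse (mag (W scl mag x0 \<omega> s))) (W scl mag x0 \<omega>), s)
             * ennreal (mag (W scl mag x0 \<omega> s) powr \<alpha>)) \<partial>lam) \<partial>Q)"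
      unfolding palm_left[OF g] palm_right[OF g]
      by (rule S.tail_imp_palm[OF _ g]) (rule tail[rule_format])
  next
    fix g :: "('g \<Rightarrow> 'h) \<times> 'g \<Rightarrow> ennreal"
    assume palm: "\<forall>g::('g \<Rightarrow> 'h) \<times> 'g \<Rightarrow> ennreal. g \<in> borel_measurable (MF \<Otimes>\<^sub>M borel) \<longrightarrow>
      (\<integral>\<^sup>+\<omega>. (\<integral>\<^sup>+s. g (shift s (W scl mag x0 \<omega>), - s)
          * indicator {s. mag (W scl mag x0 \<omega> s) > 0} s \<partial>lam) \<partial>Q)
      = (\<integral>\<^sup>+\<omega>. (\<integral>\<^sup>+s.
          (if mag (W scl mag x0 \<omega> s) = 0 then 0
           else g (scale_fun scl (inverse (mag (W scl mag x0 \<omega> s))) (W scl mag x0 \<omega>), s)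
             * ennreal (mag (W scl mag x0 \<omega> s) powr \<alpha>)) \<partial>lam) \<partial>Q)"
      and g: "g \<in> borel_measurable (MF \<Otimes>\<^sub>M borel)"
    show "(\<integral>\<^sup>+u. \<integral>\<^sup>+(\<omega>, s). g (pscale scl u (shift s \<omega>), - s) * indicator {1<..} (u * mag (\<omega> s)) \<partial>?M \<partial>pareto \<alpha>) =
      (\<integral>\<^sup>+u. \<integral>\<^sup>+(\<omega>, s). g (pscale scl u \<omega>, s) * indicator {1<..} (u * mag (\<omega> s)) \<partial>?M \<partial>pareto \<alpha>)"
    proof (rule S.palm_imp_tail[OF _ g])
      fix h :: "('g \<Rightarrow> 'h) \<times> 'g \<Rightarrow> ennreal"
      assume h: "h \<in> borel_measurable (MF \<Otimes>\<^sub>M borel)"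
      show "(\<integral>\<^sup>+(\<omega>, s). h (shift s \<omega>, - s) * indicator {0<..} (mag (\<omega> s)) \<partial>?M) =
          (\<integral>\<^sup>+(\<omega>, s). h (pscale scl (inverse (mag (\<omega> s))) \<omega>, s) * ennreal (mag (\<omega> s) powr \<alpha>) \<partial>?M)"
        using palm[rule_format, OF h] unfolding palm_left[OF h] palm_right[OF h] .
    qed
  qed
qed

end
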